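(* Let $\kappa>0$, let $x,y\in\mathbb R^3$ with $0<\|x-y\|<2/\kappa$, and let $\mathcal R=\mathcal R(x,y)$ be the associated region. Then $cl(\mathcal R)$ encloses only embedded arcs: every arc-length parametrised curve $\gamma:[0,s]\to\mathbb R^3$ with $\gamma(0)\neq\gamma(s)$ that is $C^1$ and piecewise $C^2$, satisfies $\|\gamma''(t)\|\le\kappa$ wherever $\gamma''(t)$ is defined, and has image contained in $cl(\mathcal R)$, is embedded.
   Context: Piecewise $C^2$ means that the second derivative fails to exist at finitely many points at most. For points $x,y$ with $0<\|x-y\|<2/\kappa$, each circle of radius $1/\kappa$ in $\mathbb R^3$ passing through $x$ and $y$ is divided by $x,y$ into two arcs; the shorter one is called its short arc. $\mathcal R$ is the open region of $\mathbb R^3$ enclosed by the union of the short arcs of all circles of radius $1/\kappa$ passing through $x$ and $y$ (a spindle with tips $x$ and $y$). $cl$ denotes closure. *)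

theory Defs
  imports "HOL-Analysis.Analysis"
begin

definition circle_point ::
    "real^3 \<Rightarrow> real^3 \<Rightarrow> real^3 \<Rightarrow> real \<Rightarrow> real \<Rightarrow> real^3" where
  "circle_point c u v r t = c + (r * cos t) *\<^sub>R u + (r * sin t) *\<^sub>R v"

(* The points at parameters a and b divide the circle with centre c and orthonormal frame u, v into
   the arcs over [a, b] and [b, a + 2 pi], of lengths r (b - a) and r (a + 2 pi - b); A is the first
   of these and is the shorter one.  Asking for x at a and y at b loses nothing, since replacing v
   by - v reverses the orientation of the circle. *)
definition short_arc :: "real \<Rightarrow> real^3 \<Rightarrow> real^3 \<Rightarrow> (real^3) set \<Rightarrow> bool" where
  "short_arc r x y A \<longleftrightarrow>
     (\<exists>c u v a b. norm u = 1 \<and> norm v = 1 \<and> orthogonal u v \<and>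
        a < b \<and> b < a + 2 * pi \<and>
        circle_point c u v r a = x \<and> circle_point c u v r b = y \<and>
        r * (b - a) < r * (a + 2 * pi - b) \<and>
        A = circle_point c u v r ` {a..b})"

definition spindle :: "real \<Rightarrow> real^3 \<Rightarrow> real^3 \<Rightarrow> (real^3) set" where
  "spindle \<kappa> x y = inside (\<Union> {A. short_arc (1 / \<kappa>) x y A})"

(* Derivatives on [0, s] are one-sided at the two end points. *)
definition velocity :: "real \<Rightarrow> (real \<Rightarrow> real^3) \<Rightarrow> real \<Rightarrow> real^3" where
  "velocity s \<gamma> t = vector_derivative \<gamma> (at t within {0..s})"

definition acceleration :: "real \<Rightarrow> (real \<Rightarrow> real^3) \<Rightarrow> real \<Rightarrow> real^3" where
  "acceleration s \<gamma> t = vector_derivative (velocity s \<gamma>) (at t within {0..s})"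

definition C1_curve :: "real \<Rightarrow> (real \<Rightarrow> real^3) \<Rightarrow> bool" where
  "C1_curve s \<gamma> \<longleftrightarrow>
     (\<forall>t\<in>{0..s}. \<gamma> differentiable (at t within {0..s})) \<and> continuous_on {0..s} (velocity s \<gamma>)"

definition arc_length_parametrised :: "real \<Rightarrow> (real \<Rightarrow> real^3) \<Rightarrow> bool" where
  "arc_length_parametrised s \<gamma> \<longleftrightarrow> (\<forall>t\<in>{0..s}. norm (velocity s \<gamma> t) = 1)"

definition has_second_derivative :: "real \<Rightarrow> (real \<Rightarrow> real^3) \<Rightarrow> real \<Rightarrow> bool" where
  "has_second_derivative s \<gamma> t \<longleftrightarrow> velocity s \<gamma> differentiable (at t within {0..s})"

(* Only existence of the second derivative off a finite set is asked for, not its continuity. *)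
definition piecewise_C2 :: "real \<Rightarrow> (real \<Rightarrow> real^3) \<Rightarrow> bool" where
  "piecewise_C2 s \<gamma> \<longleftrightarrow> finite {t \<in> {0..s}. \<not> has_second_derivative s \<gamma> t}"

end

theory Submission
  imports Defs
begin

text \<open>
  The whole spindle lies in the closed ball that has the segment from \<open>x\<close> to \<open>y\<close> as a diameter:
  seen from a point of a short arc this segment subtends an obtuse angle, and a ball is convex,
  so that it contains whatever its subsets enclose. The radius of this ball is strictly smaller
  than \<open>1 / \<kappa>\<close>, and this prevents a curve of curvature at most \<open>\<kappa>\<close> inside it from
  meeting itself. Suppose that the curve closes up on a parameter interval of length \<open>L\<close>. Two
  estimates of \<open>L\<close> contradict each other.

  A curve of curvature at most \<open>\<kappa>\<close> in a ball of radius less than \<open>1 / \<kappa>\<close> is short, \<open>\<kappa> L < \<pi>\<close>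
  (\<open>length_less_if_in_small_ball\<close>). With \<open>g\<close> the distance to the centre, the positive function
  \<open>k = (1 / \<kappa>\<^sup>2 - g\<^sup>2) / 2\<close> satisfies \<open>k'' + \<kappa>\<^sup>2 k \<le> - (1 - \<kappa> g)\<^sup>2 / 2 \<le> 0\<close>, and by Sturm comparison
  with the sine such a function cannot stay positive on a closed interval of length \<open>\<pi> / \<kappa>\<close>.

  A curve of curvature at most \<open>\<kappa>\<close> with \<open>\<kappa> L < \<pi>\<close> does not close up (\<open>short_curve_not_closed\<close>).
  Its velocity turns by less than \<open>\<pi> / 2\<close> away from its value \<open>n\<close> at the middle of the interval, so
  that the curve moves forward in the direction \<open>n\<close> all the time.

  The acceleration is defined off a finite set only and need not be continuous. Every
  inequality that involves it is therefore used in the form of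
  \<open>mono_if_deriv_nonneg_off_finite\<close>.
\<close>

section \<open>Monotonicity and enclosed regions\<close>

text \<open>The Henstock--Kurzweil form of the fundamental theorem of calculus integrates any
  derivative, so the result holds for derivatives that are not Lebesgue integrable.\<close>
lemma mono_if_deriv_nonneg_off_finite:
  fixes f f' :: "real \<Rightarrow> real"
  assumes "a \<le> b" "finite F" and cont: "continuous_on {a..b} f"
    and der: "\<And>t. t \<in> {a..b} - F \<Longrightarrow> (f has_vector_derivative f' t) (at t within {a..b})"
    and nonneg: "\<And>t. t \<in> {a..b} - F \<Longrightarrow> 0 \<le> f' t"
  shows "f a \<le> f b"
proof -
  define g where "g t = (if t \<in> F then 0 else f' t)" for t
  have "(g has_integral (f b - f a)) {a..b}"
  proof (rule fundamental_theorem_of_calculus_interior_strong[OF \<open>finite F\<close> \<open>a \<le> b\<close> _ cont])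
    fix t assume t: "t \<in> {a<..<b} - F"
    then show "(f has_vector_derivative g t) (at t)"
      using der[of t] at_within_Icc_at[of a t b] by (simp add: g_def)
  qed
  moreover have "0 \<le> g t" if "t \<in> {a..b}" for t
    using nonneg[of t] that by (simp add: g_def)
  ultimately have "0 \<le> f b - f a"
    by (rule has_integral_nonneg)
  then show ?thesis by simp
qed

lemma inside_subset_convex:
  fixes S K :: "'a::{real_normed_vector, perfect_space} set"
  assumes "convex K" "S \<subseteq> K"
  shows "inside S \<subseteq> K"
proof -
  have "inside S \<subseteq> inside K \<union> K"
    using inside_mono[OF \<open>S \<subseteq> K\<close>] by blast
  then show ?thesis
    using inside_convex[OF \<open>convex K\<close>] by simp
qed

section \<open>Curves of bounded curvature\<close>

text \<open>The curve \<open>q\<close> has unit velocity \<open>v\<close> and, off the exceptional set \<open>F\<close>, acceleration \<open>w\<close>. The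
  derivatives are taken within \<open>{a..b}\<close>, and thus one-sided at the end points, so that the
  assumptions pass to subintervals.\<close>
locale bounded_curvature_curve =
  fixes a b \<kappa> :: real and q v w :: "real \<Rightarrow> 'a::real_inner" and F :: "real set"
  assumes curvature_pos: "0 < \<kappa>"
    and finite_F: "finite F"
    and q_deriv: "\<And>t. t \<in> {a..b} \<Longrightarrow> (q has_vector_derivative v t) (at t within {a..b})"
    and v_cont: "continuous_on {a..b} v"
    and v_unit: "\<And>t. t \<in> {a..b} \<Longrightarrow> norm (v t) = 1"
    and v_deriv: "\<And>t. t \<in> {a..b} - F \<Longrightarrow> (v has_vector_derivative w t) (at t within {a..b})"
    and w_bound: "\<And>t. t \<in> {a..b} - F \<Longrightarrow> norm (w t) \<le> \<kappa>"
begin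

lemma subinterval:
  assumes "a \<le> c" "d \<le> b"
  shows "bounded_curvature_curve c d \<kappa> q v w F"
proof
  have sub: "{c..d} \<subseteq> {a..b}" using assms by auto
  show "(q has_vector_derivative v t) (at t within {c..d})" if "t \<in> {c..d}" for t
    using has_vector_derivative_within_subset[OF q_deriv sub] that sub by blast
  show "continuous_on {c..d} v"
    using continuous_on_subset[OF v_cont sub] .
  show "(v has_vector_derivative w t) (at t within {c..d})" if "t \<in> {c..d} - F" for t
    using has_vector_derivative_within_subset[OF v_deriv sub] that sub by blast
qed (use assms curvature_pos finite_F v_unit w_bound in auto)

lemma q_cont: "continuous_on {a..b} q"
  using q_deriv has_vector_derivative_continuous continuous_on_eq_continuous_within by blast

lemma acceleration_orthogonal_velocity:
  assumes "a < b" and t: "t \<in> {a..b} - F"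
  shows "v t \<bullet> w t = 0"
proof -
  have "((\<lambda>t. v t \<bullet> v t) has_vector_derivative v t \<bullet> w t + w t \<bullet> v t) (at t within {a..b})"
    using bounded_bilinear.has_vector_derivative[OF bounded_bilinear_inner v_deriv[OF t] v_deriv[OF t]] .
  moreover have "((\<lambda>t. v t \<bullet> v t) has_vector_derivative 0) (at t within {a..b})"
    by (rule has_vector_derivative_transform[OF _ _ has_vector_derivative_const[of 1]])
       (use t v_unit in \<open>auto simp: dot_square_norm\<close>)
  ultimately have "v t \<bullet> w t + w t \<bullet> v t = 0"
    using vector_derivative_unique_within_closed_interval[OF \<open>a < b\<close>, of t] t by (auto simp: cbox_interval)
  then show ?thesis by (simp add: inner_commute)
qed

text \<open>Only the part of \<open>n\<close> orthogonal to the velocity contributes to \<open>w t \<bullet> n\<close>, and by Pythagoras its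
  length is the square root on the right.\<close>
lemma norm_w_dot_le:
  assumes "a < b" and t: "t \<in> {a..b} - F" and n: "norm n = 1"
  shows "\<bar>w t \<bullet> n\<bar> \<le> \<kappa> * sqrt (1 - (v t \<bullet> n)\<^sup>2)"
proof -
  let ?m = "n - (v t \<bullet> n) *\<^sub>R v t"
  have "w t \<bullet> n = w t \<bullet> ?m"
    using acceleration_orthogonal_velocity[OF assms(1,2)]
    by (simp add: inner_diff_right inner_commute[of "w t"])
  moreover have "norm ?m = sqrt (1 - (v t \<bullet> n)\<^sup>2)"
  proof -
    have "v t \<bullet> v t = 1" "n \<bullet> n = 1" using v_unit t n by (auto simp: dot_square_norm)
    then have "?m \<bullet> ?m = 1 - (v t \<bullet> n)\<^sup>2"
      by (simp add: inner_diff_left inner_diff_right inner_commute power2_eq_square algebra_simps)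
    then show ?thesis by (simp add: norm_eq_sqrt_inner)
  qed
  moreover have "\<bar>w t \<bullet> ?m\<bar> \<le> \<kappa> * norm ?m"
    using Cauchy_Schwarz_ineq2[of "w t" ?m] mult_right_mono[OF w_bound[OF t], of "norm ?m"] by simp
  ultimately show ?thesis by simp
qed

text \<open>The velocity, as a point of the unit sphere, moves with speed at most \<open>\<kappa>\<close>, so its
  angle to \<open>n\<close> changes at most at this rate. That angle is \<open>\<pi> / 2 - arcsin (v t \<bullet> n)\<close>, which is not differentiable
  where \<open>v t\<close> is \<open>\<plusminus> n\<close>. The factor \<open>\<mu> < 1\<close> keeps the argument of the arcsine away from \<open>\<plusminus> 1\<close> and
  does not increase the speed, since \<open>\<mu>\<^sup>2 (1 - p\<^sup>2) \<le> 1 - (\<mu> p)\<^sup>2\<close>.\<close>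
lemma arcsin_velocity_lipschitz:
  assumes "a < b" and n: "norm n = 1" and l: "0 < \<mu>" "\<mu> < 1" and tu: "t \<in> {a..b}" "u \<in> {a..b}" "t \<le> u"
  shows "\<bar>arcsin (\<mu> * (v u \<bullet> n)) - arcsin (\<mu> * (v t \<bullet> n))\<bar> \<le> \<kappa> * (u - t)"
proof (cases "t = u")
  case False
  then have "t < u" using tu by simp
  interpret sub: bounded_curvature_curve t u \<kappa> q v w F
    using subinterval tu by simp
  define p where "p r = arcsin (\<mu> * (v r \<bullet> n))" for r
  have bound: "\<bar>v r \<bullet> n\<bar> \<le> 1" if "r \<in> {t..u}" for r
    using Cauchy_Schwarz_ineq2[of "v r" n] sub.v_unit[OF that] n by simp
  have inner: "\<bar>\<mu> * (v r \<bullet> n)\<bar> < 1" if "r \<in> {t..u}" for r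
  proof -
    have "\<mu> * \<bar>v r \<bullet> n\<bar> \<le> \<mu> * 1"
      using bound[OF that] l by (intro mult_left_mono) auto
    also have "\<dots> < 1" using l by simp
    finally show ?thesis using l by (simp add: abs_mult)
  qed
  have cont: "continuous_on {t..u} p"
    unfolding p_def by (intro continuous_intros sub.v_cont) (use inner in \<open>force\<close>)+
  define p' where "p' r = \<mu> * (w r \<bullet> n) / sqrt (1 - (\<mu> * (v r \<bullet> n))\<^sup>2)" for r
  have der: "(p has_vector_derivative p' r) (at r within {t..u})" if r: "r \<in> {t..u} - F" for r
  proof -
    have "((\<lambda>r. \<mu> * (v r \<bullet> n)) has_real_derivative \<mu> * (w r \<bullet> n)) (at r within {t..u})"
      using bounded_linear.has_vector_derivative[OF bounded_linear_inner_left sub.v_deriv[OF r], of n]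
      by (intro DERIV_cmult) (simp add: has_real_derivative_iff_has_vector_derivative)
    moreover have "-1 < \<mu> * (v r \<bullet> n)" "\<mu> * (v r \<bullet> n) < 1" using inner[of r] r by auto
    ultimately have "(p has_real_derivative inverse (sqrt (1 - (\<mu> * (v r \<bullet> n))\<^sup>2)) * (\<mu> * (w r \<bullet> n)))
        (at r within {t..u})"
      unfolding p_def by (intro DERIV_chain2[OF DERIV_arcsin])
    then show ?thesis
      by (simp add: has_real_derivative_iff_has_vector_derivative p'_def divide_inverse mult.commute)
  qed
  have bnd: "\<bar>p' r\<bar> \<le> \<kappa>" if r: "r \<in> {t..u} - F" for r
  proof -
    have pos: "0 < 1 - (\<mu> * (v r \<bullet> n))\<^sup>2"
      using inner[of r] r by (simp add: abs_square_less_1)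
    have "\<mu> * \<bar>w r \<bullet> n\<bar> \<le> \<mu> * (\<kappa> * sqrt (1 - (v r \<bullet> n)\<^sup>2))"
      using sub.norm_w_dot_le[OF \<open>t < u\<close> r n] l by simp
    also have "\<dots> = \<kappa> * sqrt (\<mu>\<^sup>2 - (\<mu> * (v r \<bullet> n))\<^sup>2)"
    proof -
      have "\<mu>\<^sup>2 - (\<mu> * (v r \<bullet> n))\<^sup>2 = \<mu>\<^sup>2 * (1 - (v r \<bullet> n)\<^sup>2)"
        by (simp add: algebra_simps power_mult_distrib)
      then show ?thesis using l by (simp add: real_sqrt_mult)
    qed
    also have "\<dots> \<le> \<kappa> * sqrt (1 - (\<mu> * (v r \<bullet> n))\<^sup>2)"
      using l curvature_pos by (simp add: power_le_one)
    finally show ?thesis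
      using pos l by (simp add: p'_def abs_mult divide_simps)
  qed
  have lower: "0 \<le> p' r + \<kappa>" and upper: "p' r \<le> \<kappa>" if "r \<in> {t..u} - F" for r
    using bnd[OF that] by auto
  have "p t + \<kappa> * t \<le> p u + \<kappa> * u"
    by (rule mono_if_deriv_nonneg_off_finite[OF less_imp_le[OF \<open>t < u\<close>] finite_F, where f' = "\<lambda>r. p' r + \<kappa>"])
       (auto intro!: continuous_intros cont derivative_eq_intros der lower)
  moreover have "\<kappa> * t - p t \<le> \<kappa> * u - p u"
    by (rule mono_if_deriv_nonneg_off_finite[OF less_imp_le[OF \<open>t < u\<close>] finite_F, where f' = "\<lambda>r. \<kappa> - p' r"])
       (auto intro!: continuous_intros cont derivative_eq_intros der upper)
  ultimately show ?thesis by (simp add: p_def algebra_simps)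
qed simp

text \<open>Within half the length of the interval from its middle, the velocity turns by less than \<open>\<pi> / 2\<close>
  and so keeps a positive component along its middle value.\<close>
lemma short_curve_not_closed:
  assumes "a < b" and short: "\<kappa> * (b - a) < pi"
  shows "q a \<noteq> q b"
proof -
  define m where "m = (a + b) / 2"
  define n where "n = v m"
  have m: "m \<in> {a..b}" using \<open>a < b\<close> by (simp add: m_def)
  have n: "norm n = 1" using v_unit m by (simp add: n_def)
  \<comment> \<open>With \<open>\<mu> = sin \<beta>\<close> the arcsine starts from \<open>\<beta>\<close> at the middle of the interval. It decreases by at
    most \<open>\<kappa> (b - a) / 2 < \<beta>\<close> up to either end and therefore stays positive.\<close>
  obtain \<beta> where \<beta>: "\<kappa> * (b - a) / 2 < \<beta>" "\<beta> < pi / 2"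
    using dense[of "\<kappa> * (b - a) / 2" "pi / 2"] short by auto
  have "0 < \<kappa> * (b - a)" using curvature_pos \<open>a < b\<close> by simp
  then have "0 < \<beta>" using \<beta> by simp
  have l: "0 < sin \<beta>" "sin \<beta> < 1"
    using \<open>0 < \<beta>\<close> \<beta> sin_gt_zero[of \<beta>] sin_monotone_2pi[of \<beta> "pi/2"] by auto
  have pos: "0 < v t \<bullet> n" if t: "t \<in> {a..b}" for t
  proof -
    have "\<bar>arcsin (sin \<beta> * (v t \<bullet> n)) - arcsin (sin \<beta> * (v m \<bullet> n))\<bar> \<le> \<kappa> * \<bar>t - m\<bar>"
      using arcsin_velocity_lipschitz[OF \<open>a < b\<close> n l t m] arcsin_velocity_lipschitz[OF \<open>a < b\<close> n l m t]
      by (cases "t \<le> m") (auto simp: abs_minus_commute)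
    moreover have "\<kappa> * \<bar>t - m\<bar> \<le> \<kappa> * ((b - a) / 2)"
      using t curvature_pos by (intro mult_left_mono) (auto simp: m_def abs_if field_simps)
    moreover have "arcsin (sin \<beta> * (v m \<bullet> n)) = \<beta>"
      using n \<open>0 < \<beta>\<close> \<beta> by (simp add: n_def dot_square_norm arcsin_sin)
    ultimately have "0 < arcsin (sin \<beta> * (v t \<bullet> n))" using \<beta> by auto
    moreover have "\<bar>sin \<beta> * (v t \<bullet> n)\<bar> \<le> 1"
    proof -
      have "\<bar>v t \<bullet> n\<bar> \<le> 1" using Cauchy_Schwarz_ineq2[of "v t" n] v_unit[OF t] n by simp
      then show ?thesis using l by (simp add: abs_mult mult_le_one)
    qed
    ultimately have "0 < sin \<beta> * (v t \<bullet> n)"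
      using arcsin_less_mono[of 0 "sin \<beta> * (v t \<bullet> n)"] by simp
    then show ?thesis using l by (simp add: zero_less_mult_iff)
  qed
  have der: "((\<lambda>t. q t \<bullet> n) has_real_derivative v t \<bullet> n) (at t within {a..b})" if "t \<in> {a..b}" for t
    using bounded_linear.has_vector_derivative[OF bounded_linear_inner_left q_deriv[OF that], of n]
    by (simp add: has_real_derivative_iff_has_vector_derivative)
  have "q a \<bullet> n < q b \<bullet> n"
  proof (rule DERIV_pos_imp_increasing_open[OF \<open>a < b\<close>])
    fix t assume "a < t" "t < b"
    then show "\<exists>y. ((\<lambda>t. q t \<bullet> n) has_real_derivative y) (at t) \<and> 0 < y"
      using der[of t] pos[of t] at_within_Icc_at[of a t b] by auto
  qed (intro continuous_intros q_cont)
  then show ?thesis by auto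
qed

text \<open>Otherwise there is a subinterval \<open>{a..d}\<close> of length \<open>\<pi> / \<kappa>\<close>. Let \<open>W\<close> be the Wronskian of
  \<open>k\<close> and \<open>sin (\<kappa> (t - a))\<close>, where \<open>k = (1 / \<kappa>\<^sup>2 - g\<^sup>2) / 2\<close> for the distance \<open>g\<close> to the centre. Since
  \<open>W' = (k'' + \<kappa>\<^sup>2 k) sin (\<kappa> (t - a)) \<le> 0\<close>, its end values satisfy \<open>\<kappa> k d = W d \<le> W a = - \<kappa> k a\<close>,
  although \<open>k\<close> is positive at both ends.\<close>
lemma length_less_if_in_small_ball:
  assumes small: "\<kappa> * R < 1" and ball: "\<And>t. t \<in> {a..b} \<Longrightarrow> norm (q t - c) \<le> R"
  shows "\<kappa> * (b - a) < pi"
proof (rule ccontr)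
  assume "\<not> \<kappa> * (b - a) < pi"
  define d where "d = a + pi / \<kappa>"
  have "a < d" using curvature_pos by (simp add: d_def)
  have "d \<le> b" using \<open>\<not> \<kappa> * (b - a) < pi\<close> curvature_pos by (simp add: d_def field_simps)
  interpret sub: bounded_curvature_curve a d \<kappa> q v w F
    using subinterval \<open>d \<le> b\<close> by simp
  define k where "k t = (1 / \<kappa>\<^sup>2 - (q t - c) \<bullet> (q t - c)) / 2" for t
  define W where "W t = - (v t \<bullet> (q t - c)) * sin (\<kappa> * (t - a)) - \<kappa> * k t * cos (\<kappa> * (t - a))" for t
  have k_pos: "0 < k t" if "t \<in> {a..d}" for t
  proof -
    have "norm (q t - c) \<le> R" using ball that \<open>d \<le> b\<close> by auto
    then have "\<kappa> * norm (q t - c) < 1" using small curvature_pos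
      by (meson le_less_trans mult_left_mono less_imp_le)
    then have "(\<kappa> * norm (q t - c))\<^sup>2 < 1"
      using curvature_pos by (simp add: abs_square_less_1 abs_mult)
    then show ?thesis
      using curvature_pos by (simp add: k_def dot_square_norm power_mult_distrib field_simps)
  qed
  have "- W a \<le> - W d"
  proof (rule mono_if_deriv_nonneg_off_finite[OF less_imp_le[OF \<open>a < d\<close>] finite_F])
    show "continuous_on {a..d} (\<lambda>t. - W t)"
      unfolding W_def k_def by (intro continuous_intros sub.v_cont sub.q_cont) auto
    let ?W' = "\<lambda>t. (w t \<bullet> (q t - c) + 1 - \<kappa>\<^sup>2 * k t) * sin (\<kappa> * (t - a))"
    show "((\<lambda>t. - W t) has_vector_derivative ?W' t) (at t within {a..d})" if t: "t \<in> {a..d} - F" for t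
    proof -
      have q: "((\<lambda>t. q t - c) has_vector_derivative v t) (at t within {a..d})"
        using sub.q_deriv t by (auto intro!: derivative_eq_intros)
      have one: "v t \<bullet> v t = 1" using sub.v_unit t by (simp add: dot_square_norm)
      have vq: "((\<lambda>t. v t \<bullet> (q t - c)) has_real_derivative 1 + w t \<bullet> (q t - c)) (at t within {a..d})"
        using bounded_bilinear.has_vector_derivative[OF bounded_bilinear_inner sub.v_deriv[OF t] q]
        by (simp add: has_real_derivative_iff_has_vector_derivative one)
      have qq: "((\<lambda>t. (q t - c) \<bullet> (q t - c)) has_real_derivative 2 * (v t \<bullet> (q t - c))) (at t within {a..d})"
        using bounded_bilinear.has_vector_derivative[OF bounded_bilinear_inner q q]
        by (simp add: has_real_derivative_iff_has_vector_derivative inner_commute)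
      have "(k has_real_derivative (0 - 2 * (v t \<bullet> (q t - c))) / 2) (at t within {a..d})"
        unfolding k_def by (intro DERIV_cdivide DERIV_diff DERIV_const qq)
      then have k: "(k has_real_derivative - (v t \<bullet> (q t - c))) (at t within {a..d})"
        by simp
      have sin: "((\<lambda>t. sin (\<kappa> * (t - a))) has_real_derivative \<kappa> * cos (\<kappa> * (t - a))) (at t within {a..d})"
        and cos: "((\<lambda>t. cos (\<kappa> * (t - a))) has_real_derivative - \<kappa> * sin (\<kappa> * (t - a))) (at t within {a..d})"
        by (auto intro!: derivative_eq_intros)
      have "((\<lambda>t. - W t) has_real_derivative ?W' t) (at t within {a..d})"
        unfolding W_def
        by (rule DERIV_cong[OF DERIV_minus[OF DERIV_diff[OF DERIV_mult[OF DERIV_minus[OF vq] sin]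
              DERIV_mult[OF DERIV_cmult[OF k] cos]]]])
           (simp add: algebra_simps power2_eq_square)
      then show ?thesis by (simp add: has_real_derivative_iff_has_vector_derivative)
    qed
    show "0 \<le> ?W' t" if t: "t \<in> {a..d} - F" for t
    proof -
      let ?g = "norm (q t - c)"
      have "\<bar>w t \<bullet> (q t - c)\<bar> \<le> \<kappa> * ?g"
        using Cauchy_Schwarz_ineq2[of "w t" "q t - c"] mult_right_mono[OF sub.w_bound[OF t], of ?g] by simp
      \<comment> \<open>Completing the square turns the curvature bound into \<open>k'' + \<kappa>\<^sup>2 k \<le> 0\<close>.\<close>
      moreover have "1 - \<kappa>\<^sup>2 * k t - \<kappa> * ?g = (1 - \<kappa> * ?g)\<^sup>2 / 2"
        using curvature_pos by (simp add: k_def dot_square_norm field_simps power2_eq_square)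
      ultimately have "0 \<le> w t \<bullet> (q t - c) + 1 - \<kappa>\<^sup>2 * k t"
        using zero_le_power2[of "1 - \<kappa> * ?g"] by linarith
      moreover have "0 \<le> sin (\<kappa> * (t - a))"
        using t curvature_pos by (intro sin_ge_zero) (auto simp: d_def field_simps)
      ultimately show ?thesis by simp
    qed
  qed
  moreover have "W a = - \<kappa> * k a" by (simp add: W_def)
  moreover have "W d = \<kappa> * k d" using curvature_pos by (simp add: W_def d_def)
  moreover have "0 < \<kappa> * k a" "0 < \<kappa> * k d"
    using k_pos \<open>a < d\<close> curvature_pos by auto
  ultimately show False by simp
qed

lemma inj_on_if_in_small_ball:
  assumes "\<kappa> * R < 1" and ball: "\<And>t. t \<in> {a..b} \<Longrightarrow> norm (q t - c) \<le> R"
  shows "inj_on q {a..b}"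
proof (rule linorder_inj_onI)
  fix t u assume tu: "t < u" "t \<in> {a..b}" "u \<in> {a..b}"
  interpret sub: bounded_curvature_curve t u \<kappa> q v w F
    using subinterval tu by simp
  have "\<kappa> * (u - t) < pi"
    by (rule sub.length_less_if_in_small_ball[OF assms(1), of c]) (use ball tu in auto)
  then show "q t \<noteq> q u"
    by (rule sub.short_curve_not_closed[OF \<open>t < u\<close>])
qed auto

end

section \<open>The spindle\<close>

text \<open>As in the theorem of Thales, \<open>p\<close> lies in the ball with diameter \<open>xy\<close> exactly if
  \<open>(p - x) \<bullet> (p - y) \<le> 0\<close>. If the arc has half-angle \<open>h\<close> and \<open>p\<close> has angle \<open>t - m\<close> from its middle, the
  inner product is \<open>2 r\<^sup>2 cos h (cos h - cos (t - m))\<close>. Here \<open>\<bar>t - m\<bar> \<le> h\<close>, and \<open>h < \<pi> / 2\<close>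
  because the arc is the short one.\<close>
lemma short_arc_subset_ball:
  assumes "short_arc r x y A" "0 < r"
  shows "A \<subseteq> cball (midpoint x y) (norm (x - y) / 2)"
proof
  fix p assume "p \<in> A"
  from assms obtain c u v a b where uv: "norm u = 1" "norm v = 1" "orthogonal u v"
    and ab: "a < b" "r * (b - a) < r * (a + 2 * pi - b)"
    and x: "x = circle_point c u v r a" and y: "y = circle_point c u v r b"
    and A: "A = circle_point c u v r ` {a..b}"
    unfolding short_arc_def by blast
  from \<open>p \<in> A\<close> A obtain t where t: "t \<in> {a..b}" and p: "p = circle_point c u v r t" by auto
  define m h where "m = (a + b) / 2" and "h = (b - a) / 2"
  have a: "a = m - h" and b: "b = m + h" by (simp_all add: m_def h_def field_simps)
  have h: "0 < h" "h < pi / 2" using ab \<open>0 < r\<close> by (simp_all add: h_def)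
  have [simp]: "u \<bullet> u = 1" "v \<bullet> v = 1" "u \<bullet> v = 0" "v \<bullet> u = 0"
    using uv by (auto simp: dot_square_norm orthogonal_def inner_commute)
  have inner_in_frame: "((c + (r * p1) *\<^sub>R u + (r * p2) *\<^sub>R v) - (c + (r * x1) *\<^sub>R u + (r * x2) *\<^sub>R v))
      \<bullet> ((c + (r * p1) *\<^sub>R u + (r * p2) *\<^sub>R v) - (c + (r * y1) *\<^sub>R u + (r * y2) *\<^sub>R v))
    = r\<^sup>2 * ((p1 - x1) * (p1 - y1) + (p2 - x2) * (p2 - y2))" for p1 p2 x1 x2 y1 y2
    by (simp add: inner_add_left inner_add_right inner_diff_left inner_diff_right algebra_simps power2_eq_square)
  have "(p - x) \<bullet> (p - y) = r\<^sup>2 * ((cos t - cos a) * (cos t - cos b) + (sin t - sin a) * (sin t - sin b))"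
    unfolding p x y circle_point_def by (rule inner_in_frame)
  also have "(cos t - cos a) * (cos t - cos b) + (sin t - sin a) * (sin t - sin b)
     = (cos t * cos t + sin t * sin t) - (cos t * cos a + sin t * sin a) - (cos t * cos b + sin t * sin b)
       + (cos b * cos a + sin b * sin a)"
    by (simp add: algebra_simps)
  also have "\<dots> = 1 - cos (t - a) - cos (t - b) + cos (b - a)"
    by (simp add: cos_diff flip: power2_eq_square)
  also have "\<dots> = 2 * cos h * (cos h - cos (t - m))"
  proof -
    have "cos (t - a) + cos (t - b) = 2 * cos h * cos (t - m)"
      using cos_add[of "t - m" h] cos_diff[of "t - m" h] unfolding a b by (simp add: algebra_simps)
    moreover have "cos (b - a) = 2 * (cos h)\<^sup>2 - 1"
      using cos_double_cos[of h] by (simp add: a b)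
    ultimately show ?thesis by (simp add: algebra_simps power2_eq_square)
  qed
  finally have prod: "(p - x) \<bullet> (p - y) = r\<^sup>2 * (2 * cos h * (cos h - cos (t - m)))" .
  have "cos h \<le> cos \<bar>t - m\<bar>"
    using t h by (intro cos_monotone_0_pi_le) (auto simp: a b)
  moreover have "0 < cos h" using h by (simp add: cos_gt_zero)
  ultimately have "(p - x) \<bullet> (p - y) \<le> 0"
    unfolding prod by (simp add: mult_nonneg_nonpos)
  moreover have "(norm (p - midpoint x y))\<^sup>2 = (p - x) \<bullet> (p - y) + (norm (x - y) / 2)\<^sup>2"
    by (simp add: midpoint_def power_divide dot_square_norm[symmetric] inner_diff_left inner_diff_right
        inner_add_left inner_add_right inner_commute field_simps)
  ultimately have "(norm (p - midpoint x y))\<^sup>2 \<le> (norm (x - y) / 2)\<^sup>2" by simp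
  then have "norm (p - midpoint x y) \<le> norm (x - y) / 2"
    by (rule power2_le_imp_le) simp
  then show "p \<in> cball (midpoint x y) (norm (x - y) / 2)"
    by (simp add: dist_norm norm_minus_commute)
qed

lemma closure_spindle_subset_ball:
  assumes "0 < \<kappa>"
  shows "closure (spindle \<kappa> x y) \<subseteq> cball (midpoint x y) (norm (x - y) / 2)"
  unfolding spindle_def
  by (intro closure_minimal inside_subset_convex convex_cball closed_cball Sup_least)
     (use short_arc_subset_ball assms in auto)

section \<open>Curves in the closed spindle\<close>

theorem theorem3p7:
  fixes \<kappa> s :: real and x y :: "real^3" and \<gamma> :: "real \<Rightarrow> real^3"
  assumes "\<kappa> > 0"
    and "0 < norm (x - y)" and "norm (x - y) < 2 / \<kappa>"
    and "s \<ge> 0"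
    and "C1_curve s \<gamma>"
    and "piecewise_C2 s \<gamma>"
    and "arc_length_parametrised s \<gamma>"
    and "\<gamma> 0 \<noteq> \<gamma> s"
    and "\<And>t. t \<in> {0..s} \<Longrightarrow> has_second_derivative s \<gamma> t \<Longrightarrow> norm (acceleration s \<gamma> t) \<le> \<kappa>"
    and "\<gamma> ` {0..s} \<subseteq> closure (spindle \<kappa> x y)"
  shows "embedding_map (top_of_set {0..s}) euclidean \<gamma>"
proof -
  let ?F = "{t \<in> {0..s}. \<not> has_second_derivative s \<gamma> t}"
  interpret bounded_curvature_curve 0 s \<kappa> \<gamma> "velocity s \<gamma>" "acceleration s \<gamma>" ?F
  proof
    show "(\<gamma> has_vector_derivative velocity s \<gamma> t) (at t within {0..s})" if "t \<in> {0..s}" for t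
      using assms(5) that by (simp add: C1_curve_def velocity_def vector_derivative_works)
    show "(velocity s \<gamma> has_vector_derivative acceleration s \<gamma> t) (at t within {0..s})"
      if "t \<in> {0..s} - ?F" for t
      using that by (simp add: has_second_derivative_def acceleration_def vector_derivative_works)
  qed (use assms in \<open>auto simp: C1_curve_def piecewise_C2_def arc_length_parametrised_def\<close>)
  have "inj_on \<gamma> {0..s}"
  proof (rule inj_on_if_in_small_ball)
    show "\<kappa> * (norm (x - y) / 2) < 1"
      using assms(1,3) by (simp add: field_simps)
    show "norm (\<gamma> t - midpoint x y) \<le> norm (x - y) / 2" if "t \<in> {0..s}" for t
    proof -
      have "\<gamma> t \<in> cball (midpoint x y) (norm (x - y) / 2)"
        using closure_spindle_subset_ball[OF assms(1)] assms(10) that by blast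
      then show ?thesis by (simp add: dist_norm norm_minus_commute)
    qed
  qed
  then show ?thesis
    using q_cont by (intro continuous_imp_embedding_map) (auto simp: compact_space_subtopology)
qed

end
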